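(* Let $k \ge 2$, $d \ge 1$, $m \ge 1$ be integers, let $\{S_p\}_{p=1}^k$ be a partition of $\{1,\dots,m\}$, and let $n_p = |S_p|$. Fix pairwise distinct $\beta_1,\dots,\beta_k \in \mathbb{R}^d$. Let $\{(a_i,b_i)\}_{i=1}^m \subset \mathbb{R}^d\times\mathbb{R}$ satisfy $a_i^\top \beta_p = b_i$ for all $p\in\{1,\dots,k\}$ and $i \in S_p$. For $p \ne q$ let $v_{pq} = \frac{\beta_p-\beta_q}{\|\beta_p-\beta_q\|_2}$ and let $v_p = \frac{1}{\sum_{q\ne p} n_q}\sum_{q\neq p} n_q v_{pq}$; assume that $v_p \neq 0$ for every $p$ and that $P_{v_p}a_i \ne 0$ for every $p$ and every $i \in S_p$. Suppose that: (i) (well-separation) $$\max_{p\in\{1,\dots,k\}}\ \max_{i\in S_p} \frac{\|P_{v_p^\perp}a_i\|_2}{\|P_{v_p}a_i\|_2} < \frac12 \min_{p\in\{1,\dots,k\}} \frac{n_p}{m};$$ (ii) (balance) for all $p\in\{1,\dots,k\}$, $$\sum_{i\in S_p} \operatorname{sign}(v_p^\top a_i)\,\frac{P_{v_p^\perp}a_i}{\|P_{v_p}a_i\|_2} = 0;$$ (iii) for all $p \in\{1,\dots,k\}$, $\operatorname{span}\{a_i : i\in S_p\} = \mathbb{R}^d$. Then the optimization problem $$\min_{z_1,\dots,z_m\in\mathbb{R}^d}\ \sum_{i=1}^m\sum_{j=1}^m \|z_i-z_j\|_2 \quad\text{subject to } a_i^\top z_i = b_i,\ i\in\{1,\dots,m\},$$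 has a unique solution, and it is given by $z_i = \beta_{\ell_i}$ for all $i\in\{1,\dots,m\}$, where $\ell_i$ denotes the unique $p$ with $i\in S_p$.
   Context: For a nonzero vector $v\in\mathbb{R}^d$, let $\hat v = v/\|v\|_2$, $P_v = \hat v\hat v^\top$ (the orthogonal projector onto $\operatorname{span}\{v\}$) and $P_{v^\perp} = I_{d\times d} - \hat v\hat v^\top$ (the orthogonal projector onto the orthogonal complement of $v$). $\|\cdot\|_2$ is the Euclidean norm. The function $\operatorname{sign}$ takes the value $1$ on positive reals, $-1$ on negative reals, and $0$ at $0$. *)

theory Defs
  imports "HOL-Analysis.Analysis" "HOL-Library.Disjoint_Sets" "HOL-Library.FuncSet"
begin

definition normalize_vec :: "real ^ 'd \<Rightarrow> real ^ 'd" where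
  "normalize_vec v = v /\<^sub>R norm v"

text \<open>The intermediate index type \<open>1\<close> makes the product the outer product of the normalized
  vector with itself.\<close>

definition proj_span :: "real ^ 'd \<Rightarrow> real ^ 'd ^ 'd" where
  "proj_span v =
     (columnvector (normalize_vec v) :: real ^ 1 ^ 'd) **
     (rowvector (normalize_vec v) :: real ^ 'd ^ 1)"

definition proj_perp :: "real ^ 'd \<Rightarrow> real ^ 'd ^ 'd" where
  "proj_perp v = mat 1 - proj_span v"

definition mean_direction ::
    "nat \<Rightarrow> (nat \<Rightarrow> nat set) \<Rightarrow> (nat \<Rightarrow> real ^ 'd) \<Rightarrow> nat \<Rightarrow> real ^ 'd" where
  "mean_direction k S \<beta> p =
     (1 / (\<Sum>q\<in>{1..k} - {p}. real (card (S q)))) *\<^sub>R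
     (\<Sum>q\<in>{1..k} - {p}. real (card (S q)) *\<^sub>R normalize_vec (\<beta> p - \<beta> q))"

definition label :: "nat \<Rightarrow> (nat \<Rightarrow> nat set) \<Rightarrow> nat \<Rightarrow> nat" where
  "label k S i = (THE p. p \<in> {1..k} \<and> i \<in> S p)"

definition objective :: "nat \<Rightarrow> (nat \<Rightarrow> real ^ 'd) \<Rightarrow> real" where
  "objective m z = (\<Sum>i=1..m. \<Sum>j=1..m. norm (z i - z j))"

text \<open>Tuples \<open>(z\<^sub>1, \<dots>, z\<^sub>m)\<close> are represented by extensional functions on \<open>{1..m}\<close>, so that
  equality of functions is equality of tuples.\<close>

definition feasible ::
    "nat \<Rightarrow> (nat \<Rightarrow> real ^ 'd) \<Rightarrow> (nat \<Rightarrow> real) \<Rightarrow> (nat \<Rightarrow> real ^ 'd) \<Rightarrow> bool" where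
  "feasible m a b z \<longleftrightarrow>
     z \<in> {1..m} \<rightarrow>\<^sub>E UNIV \<and> (\<forall>i\<in>{1..m}. a i \<bullet> z i = b i)"

end

theory Submission imports Defs begin

text \<open>Write a feasible point as \<open>z\<^sub>i = \<beta>\<^sub>p + h\<^sub>i\<close> for \<open>i \<in> S p\<close>, so that \<open>a\<^sub>i \<bullet> h\<^sub>i = 0\<close>. Bounding
  the terms of the objective between different clusters by their linearization at \<open>\<beta>\<close>, the
  objective grows by at least the sum over \<open>p\<close> of
  \<open>W\<^sub>p + 2 (m - n\<^sub>p) (\<Sum>i\<in>S p. v\<^sub>p \<bullet> h\<^sub>i)\<close>, where \<open>W\<^sub>p = (\<Sum>i\<in>S p. \<Sum>j\<in>S p. norm (h\<^sub>i - h\<^sub>j))\<close>.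
  The constraint turns \<open>v\<^sub>p \<bullet> h\<^sub>i\<close> into \<open>- norm v\<^sub>p * (w\<^sub>i \<bullet> h\<^sub>i)\<close>, where the \<open>w\<^sub>i\<close> are the summands in
  the balance condition. As they sum to zero, \<open>n\<^sub>p (\<Sum>i\<in>S p. w\<^sub>i \<bullet> h\<^sub>i)\<close> only involves differences
  and is at most \<open>max (norm w\<^sub>i) * W\<^sub>p\<close>, so well-separation makes the growth at least a positive
  multiple of each \<open>W\<^sub>p\<close>. Equality forces \<open>h\<close> to be constant on each cluster, hence zero by the
  spanning condition.\<close>

section \<open>Subgradients of the norm and rank-one projections\<close>

lemma normalize_vec_0 [simp]: "normalize_vec 0 = 0"
  by (simp add: normalize_vec_def)

lemma norm_normalize_vec_le: "norm (normalize_vec x) \<le> 1"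
  by (cases "x = 0") (auto simp: normalize_vec_def)

lemma normalize_vec_minus: "normalize_vec (x - y) = - normalize_vec (y - x)"
  by (simp add: normalize_vec_def norm_minus_commute algebra_simps)

text \<open>Convexity: \<open>normalize_vec x\<close> is a subgradient of the norm at
  \<open>x\<close>. At \<open>x = 0\<close> it is zero, a valid but weak choice.\<close>

lemma norm_add_ge_linearization: "norm x + normalize_vec x \<bullet> y \<le> norm (x + y)"
proof (cases "x = 0")
  case False
  have "normalize_vec x \<bullet> (x + y) \<le> norm (normalize_vec x) * norm (x + y)"
    by (rule norm_cauchy_schwarz)
  also have "\<dots> \<le> norm (x + y)"
    using mult_right_mono[OF norm_normalize_vec_le[of x], of "norm (x + y)"] by simp
  finally have "normalize_vec x \<bullet> (x + y) \<le> norm (x + y)" .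
  moreover have "normalize_vec x \<bullet> x = norm x"
    using False by (simp add: normalize_vec_def dot_square_norm power2_eq_square)
  ultimately show ?thesis by (simp add: inner_add_right)
qed simp

lemma proj_span_mult: "proj_span v *v x = (normalize_vec v \<bullet> x) *\<^sub>R normalize_vec v"
  by (simp add: proj_span_def vec_eq_iff matrix_vector_mult_def matrix_matrix_mult_def
      columnvector_def rowvector_def inner_vec_def sum_distrib_left sum_distrib_right mult_ac)

lemma proj_perp_mult: "proj_perp v *v x = x - (normalize_vec v \<bullet> x) *\<^sub>R normalize_vec v"
  by (simp add: proj_perp_def matrix_vector_mult_diff_rdistrib proj_span_mult)

text \<open>If \<open>x\<close> has a nonzero component along \<open>v\<close>, the hyperplane
  orthogonal to \<open>x\<close> is a graph over the complement of \<open>v\<close>, and this vector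
  is minus the gradient of its height along \<open>normalize_vec v\<close>.\<close>

definition slope_vec :: "real ^ 'd \<Rightarrow> real ^ 'd \<Rightarrow> real ^ 'd" where
  "slope_vec v x = sgn (v \<bullet> x) *\<^sub>R ((proj_perp v *v x) /\<^sub>R norm (proj_span v *v x))"

lemma norm_slope_vec_le:
  "norm (slope_vec v x) \<le> norm (proj_perp v *v x) / norm (proj_span v *v x)"
  by (simp add: slope_vec_def sgn_if divide_inverse mult_ac)

text \<open>Split \<open>x \<bullet> h = 0\<close> along \<open>u = normalize_vec v\<close> and its
  complement, then divide by \<open>u \<bullet> x\<close>. The sign in \<open>slope_vec\<close>
  turns division by the absolute value into division by \<open>u \<bullet> x\<close> itself.\<close>

lemma inner_orthogonal_eq_slope_vec:
  assumes "proj_span v *v x \<noteq> 0" and "x \<bullet> h = 0"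
  shows "v \<bullet> h = - norm v * (slope_vec v x \<bullet> h)"
proof -
  define u where "u = normalize_vec v"
  have ux: "u \<bullet> x \<noteq> 0" and u0: "u \<noteq> 0"
    using assms(1) by (auto simp: proj_span_mult u_def)
  have v0: "v \<noteq> 0" using u0 by (auto simp: u_def)
  have v: "v = norm v *\<^sub>R u" using v0 by (simp add: u_def normalize_vec_def)
  have nu: "norm u = 1" using v0 by (simp add: u_def normalize_vec_def)
  have "sgn (v \<bullet> x) = sgn (u \<bullet> x)"
    by (subst v) (use v0 in \<open>simp add: sgn_mult\<close>)
  then have "slope_vec v x \<bullet> h = sgn (u \<bullet> x) * (- (u \<bullet> x) * (u \<bullet> h)) / \<bar>u \<bullet> x\<bar>"
    using assms(2) nu
    by (simp add: slope_vec_def proj_span_mult proj_perp_mult inner_diff_left divide_inverse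
        flip: u_def)
  also have "\<dots> = - (u \<bullet> h)"
    using ux by (simp add: sgn_if)
  finally show ?thesis by (subst v) simp
qed

section \<open>The estimate within one cluster\<close>

lemma card_mult_sum_inner_le:
  fixes w h :: "'i \<Rightarrow> 'a::real_inner"
  assumes "finite I" and "(\<Sum>i\<in>I. w i) = 0" and "\<And>i. i \<in> I \<Longrightarrow> norm (w i) \<le> c"
  shows "real (card I) * (\<Sum>i\<in>I. w i \<bullet> h i) \<le> c * (\<Sum>i\<in>I. \<Sum>j\<in>I. norm (h i - h j))"
proof -
  \<comment> \<open>This cross term vanishes with the sum of the \<open>w i\<close>, so subtracting
    it costs nothing and leaves only differences of \<open>h\<close>.\<close>
  have "(\<Sum>i\<in>I. \<Sum>j\<in>I. w i \<bullet> h j) = (\<Sum>i\<in>I. w i) \<bullet> (\<Sum>j\<in>I. h j)"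
    unfolding inner_sum_left inner_sum_right by (rule sum.swap)
  then have "real (card I) * (\<Sum>i\<in>I. w i \<bullet> h i) = (\<Sum>i\<in>I. \<Sum>j\<in>I. w i \<bullet> (h i - h j))"
    using assms(2) by (simp add: inner_diff_right sum_subtractf sum_distrib_left)
  also have "\<dots> \<le> (\<Sum>i\<in>I. \<Sum>j\<in>I. c * norm (h i - h j))"
    by (intro sum_mono order.trans[OF norm_cauchy_schwarz] mult_right_mono assms) auto
  finally show ?thesis by (simp add: sum_distrib_left)
qed

lemma cluster_excess_nonneg:
  fixes h :: "'i \<Rightarrow> 'a::real_inner"
  assumes "finite I" and "0 \<le> N" and "N < real (card I)"
    and bound: "\<And>i. i \<in> I \<Longrightarrow> norm (w i) \<le> c" and "2 * C * c \<le> N"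
    and "(\<Sum>i\<in>I. w i) = 0"
    and inner: "\<And>i. i \<in> I \<Longrightarrow> g \<bullet> h i = - s * (w i \<bullet> h i)" and "0 \<le> s" and "s \<le> C"
  defines "W \<equiv> (\<Sum>i\<in>I. \<Sum>j\<in>I. norm (h i - h j))"
  defines "T \<equiv> W + 2 * (\<Sum>i\<in>I. g \<bullet> h i)"
  shows "0 \<le> T" and "T = 0 \<Longrightarrow> i \<in> I \<Longrightarrow> j \<in> I \<Longrightarrow> h i = h j"
proof -
  let ?n = "real (card I)"
  have W: "0 \<le> W" unfolding W_def by (intro sum_nonneg) auto
  have n: "0 < ?n" using assms(2,3) by linarith
  then obtain i0 where "i0 \<in> I" by fastforce
  then have c: "0 \<le> c" using bound[of i0] norm_ge_zero order.trans by blast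
  have "?n * (2 * (\<Sum>i\<in>I. g \<bullet> h i)) = - (2 * s * (?n * (\<Sum>i\<in>I. w i \<bullet> h i)))"
    by (simp add: inner sum_distrib_left sum_negf mult_ac)
  also have "\<dots> \<ge> - (2 * s * (c * W))"
    using mult_left_mono[OF card_mult_sum_inner_le[OF assms(1,6) bound, of h], of "2 * s"] assms(8)
    by (simp add: W_def)
  finally have "?n * (2 * (\<Sum>i\<in>I. g \<bullet> h i)) \<ge> - (2 * s * (c * W))" .
  moreover have "2 * s * (c * W) \<le> N * W"
  proof -
    have "2 * s * c \<le> 2 * C * c" using assms(9) c by (intro mult_right_mono) auto
    then show ?thesis using mult_right_mono[of "2 * s * c" N W] W assms(5) by (simp add: mult_ac)
  qed
  ultimately have T: "(?n - N) * W \<le> ?n * T"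
    unfolding T_def by (simp add: algebra_simps)
  \<comment> \<open>The strict inequality \<open>N < ?n\<close> leaves a positive multiple of
    \<open>W\<close>; it gives both the sign of \<open>T\<close> and the equality case.\<close>
  have "0 \<le> (?n - N) * W" using W assms(3) by simp
  then have "0 \<le> ?n * T" using T by linarith
  then show "0 \<le> T" using n by (simp add: zero_le_mult_iff)
  show "h i = h j" if "T = 0" "i \<in> I" "j \<in> I"
  proof -
    have "(?n - N) * W \<le> 0" using T that by simp
    then have "W = 0" using W assms(3) by (simp add: mult_le_0_iff)
    then have "(\<Sum>j\<in>I. norm (h i - h j)) = 0"
      using assms(1) \<open>i \<in> I\<close> unfolding W_def by (subst (asm) sum_nonneg_eq_0_iff) (auto intro: sum_nonneg)
    then have "norm (h i - h j) = 0"
      using assms(1) \<open>j \<in> I\<close> by (subst (asm) sum_nonneg_eq_0_iff) auto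
    then show ?thesis by simp
  qed
qed

section \<open>Linearizing the objective across clusters\<close>

lemma sum_by_label:
  assumes "finite I" and "finite K" and "\<And>i. i \<in> I \<Longrightarrow> L i \<in> K"
  shows "(\<Sum>i\<in>I. f i) = (\<Sum>p\<in>K. \<Sum>i\<in>{i\<in>I. L i = p}. f i)"
  using assms by (intro sum.group[symmetric]) auto

lemma objective_excess:
  fixes \<beta> :: "'k \<Rightarrow> real ^ 'd" and h :: "'i \<Rightarrow> real ^ 'd"
  assumes fin: "finite I" "finite K" and L: "\<And>i. i \<in> I \<Longrightarrow> L i \<in> K"
    and S: "\<And>p. p \<in> K \<Longrightarrow> S p = {i\<in>I. L i = p}"
  shows "(\<Sum>i\<in>I. \<Sum>j\<in>I. norm (\<beta> (L i) - \<beta> (L j))) +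
     (\<Sum>p\<in>K. (\<Sum>i\<in>S p. \<Sum>j\<in>S p. norm (h i - h j)) +
        2 * (\<Sum>i\<in>S p. (\<Sum>q\<in>K - {p}. real (card (S q)) *\<^sub>R normalize_vec (\<beta> p - \<beta> q)) \<bullet> h i))
     \<le> (\<Sum>i\<in>I. \<Sum>j\<in>I. norm ((\<beta> (L i) + h i) - (\<beta> (L j) + h j)))"
proof -
  let ?N = "\<lambda>i j. normalize_vec (\<beta> (L i) - \<beta> (L j))"
  let ?W = "\<lambda>i j. if L i = L j then norm (h i - h j) else 0"
  let ?G = "\<lambda>p. \<Sum>q\<in>K - {p}. real (card (S q)) *\<^sub>R normalize_vec (\<beta> p - \<beta> q)"
  \<comment> \<open>Grouping by label also produces the index \<open>q = p\<close>, whose term is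
    zero because \<open>normalize_vec 0 = 0\<close>.\<close>
  have G: "(\<Sum>j\<in>I. normalize_vec (\<beta> p - \<beta> (L j))) = ?G p" if "p \<in> K" for p
  proof -
    have "(\<Sum>j\<in>I. normalize_vec (\<beta> p - \<beta> (L j)))
        = (\<Sum>q\<in>K. real (card (S q)) *\<^sub>R normalize_vec (\<beta> p - \<beta> q))"
      by (subst sum_by_label[OF fin L]) (auto simp: S sum_constant_scaleR simp del: sum_constant intro!: sum.cong)
    also have "\<dots> = ?G p"
      using that fin by (simp add: sum.remove[of K p])
    finally show ?thesis .
  qed
  \<comment> \<open>Exchanging \<open>i\<close> and \<open>j\<close> flips the sign of
    \<open>?N\<close>; this is the origin of the factor 2.\<close>
  have swap: "(\<Sum>i\<in>I. \<Sum>j\<in>I. ?N i j \<bullet> h j) = - (\<Sum>i\<in>I. \<Sum>j\<in>I. ?N i j \<bullet> h i)"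
    by (subst sum.swap, subst normalize_vec_minus) (simp add: sum_negf)
  have "(\<Sum>i\<in>I. \<Sum>j\<in>I. ?N i j \<bullet> (h i - h j)) = 2 * (\<Sum>i\<in>I. \<Sum>j\<in>I. ?N i j \<bullet> h i)"
    by (simp add: inner_diff_right sum_subtractf swap)
  also have "\<dots> = 2 * (\<Sum>i\<in>I. ?G (L i) \<bullet> h i)"
    by (simp add: L G inner_sum_left[symmetric])
  also have "\<dots> = (\<Sum>p\<in>K. 2 * (\<Sum>i\<in>S p. ?G p \<bullet> h i))"
    by (subst sum_by_label[OF fin L]) (auto simp: S sum_distrib_left intro!: sum.cong)
  finally have lin: "(\<Sum>i\<in>I. \<Sum>j\<in>I. ?N i j \<bullet> (h i - h j)) = (\<Sum>p\<in>K. 2 * (\<Sum>i\<in>S p. ?G p \<bullet> h i))" .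
  have within: "(\<Sum>i\<in>I. \<Sum>j\<in>I. ?W i j) = (\<Sum>p\<in>K. \<Sum>i\<in>S p. \<Sum>j\<in>S p. norm (h i - h j))"
    using fin
    by (subst sum_by_label[OF fin L])
      (auto simp: S sum.If_cases Int_def eq_commute conj_commute intro!: sum.cong)
  have "(\<Sum>i\<in>I. \<Sum>j\<in>I. norm (\<beta> (L i) - \<beta> (L j)) + ?W i j + ?N i j \<bullet> (h i - h j))
      \<le> (\<Sum>i\<in>I. \<Sum>j\<in>I. norm ((\<beta> (L i) + h i) - (\<beta> (L j) + h j)))"
  proof (intro sum_mono)
    fix i j
    show "norm (\<beta> (L i) - \<beta> (L j)) + ?W i j + ?N i j \<bullet> (h i - h j)
      \<le> norm ((\<beta> (L i) + h i) - (\<beta> (L j) + h j))"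
      \<comment> \<open>For equal labels the linear term is zero and equality holds through
        \<open>?W\<close>; otherwise \<open>?W\<close> is zero and the subgradient inequality
        applies.\<close>
      using norm_add_ge_linearization[of "\<beta> (L i) - \<beta> (L j)" "h i - h j"]
      by (auto simp: algebra_simps)
  qed
  then show ?thesis
    by (simp only: sum.distrib lin within add.assoc)
qed

theorem theorem1:
  fixes k m :: nat
    and S :: "nat \<Rightarrow> nat set"
    and \<beta> a v :: "nat \<Rightarrow> real ^ 'd"
    and b :: "nat \<Rightarrow> real"
  assumes "k \<ge> 2" and "m \<ge> 1"
    and "partition_on {1..m} (S ` {1..k})" and "inj_on S {1..k}"
    and "inj_on \<beta> {1..k}"
    and "\<And>p i. p \<in> {1..k} \<Longrightarrow> i \<in> S p \<Longrightarrow> a i \<bullet> \<beta> p = b i"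
    and "\<And>p. p \<in> {1..k} \<Longrightarrow> v p = mean_direction k S \<beta> p"
    and "\<And>p. p \<in> {1..k} \<Longrightarrow> v p \<noteq> 0"
    and "\<And>p i. p \<in> {1..k} \<Longrightarrow> i \<in> S p \<Longrightarrow> proj_span (v p) *v a i \<noteq> 0"
    and well_separation:
      "(MAX p\<in>{1..k}. MAX i\<in>S p. norm (proj_perp (v p) *v a i) / norm (proj_span (v p) *v a i))
         < 1 / 2 * (MIN p\<in>{1..k}. real (card (S p)) / real m)"
    and balance:
      "\<And>p. p \<in> {1..k} \<Longrightarrow>
         (\<Sum>i\<in>S p. sgn (v p \<bullet> a i) *\<^sub>R
            ((proj_perp (v p) *v a i) /\<^sub>R norm (proj_span (v p) *v a i))) = 0"
    and spanning: "\<And>p. p \<in> {1..k} \<Longrightarrow> span (a ` S p) = UNIV"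
  shows "{z. is_arg_min (objective m) (feasible m a b) z} = {\<lambda>i\<in>{1..m}. \<beta> (label k S i)}"
proof -
  let ?K = "{1..k}" and ?I = "{1..m}"

  \<comment> \<open>Labels and clusters\<close>
  define L where "L = label k S"
  define z0 where "z0 = (\<lambda>i\<in>?I. \<beta> (L i))"
  have cover: "(\<Union>p\<in>?K. S p) = ?I" and ne: "\<And>p. p \<in> ?K \<Longrightarrow> S p \<noteq> {}"
    using assms(3) by (auto simp: partition_on_def)
  have disj: "p = q" if "p \<in> ?K" "q \<in> ?K" "i \<in> S p" "i \<in> S q" for p q i
  proof -
    have "S p = S q"
      \<comment> \<open>Disjointness concerns the sets of the family; injectivity of
        \<open>S\<close> then identifies the indices.\<close>
      using disjointD[OF partition_onD2[OF assms(3)], of "S p" "S q"] that by blast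
    then show ?thesis using assms(4) that by (simp add: inj_on_eq_iff)
  qed
  have L_eq: "L i = p" if "p \<in> ?K" "i \<in> S p" for i p
    unfolding L_def label_def
  proof (rule the_equality)
    show "p \<in> ?K \<and> i \<in> S p" using that by blast
    show "q = p" if "q \<in> ?K \<and> i \<in> S q" for q
      by (rule disj[of q p i]) (use that \<open>p \<in> ?K\<close> \<open>i \<in> S p\<close> in blast)+
  qed
  have L_mem: "L i \<in> ?K" "i \<in> S (L i)" if "i \<in> ?I" for i
  proof -
    obtain p where "p \<in> ?K" "i \<in> S p" using \<open>i \<in> ?I\<close> cover by blast
    then show "L i \<in> ?K" "i \<in> S (L i)" using L_eq[of p i] by simp_all
  qed
  have S_eq: "S p = {i\<in>?I. L i = p}" if "p \<in> ?K" for p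
  proof (intro set_eqI iffI)
    fix i assume "i \<in> S p"
    then show "i \<in> {i\<in>?I. L i = p}" using that cover L_eq[OF that] by auto
  next
    fix i assume "i \<in> {i\<in>?I. L i = p}"
    then show "i \<in> S p" using L_mem(2)[of i] by simp
  qed
  have fin: "finite (S p)" if "p \<in> ?K" for p
    using S_eq[OF that] by simp
  have card_pos: "0 < card (S p)" if "p \<in> ?K" for p
    using fin ne that by (simp add: card_gt_0_iff)

  \<comment> \<open>Weights of the mean directions\<close>
  define N where "N p = (\<Sum>q\<in>?K - {p}. real (card (S q)))" for p
  have N_pos: "0 < N p" if "p \<in> ?K" for p
  proof -
    have "(if p = 1 then 2 else 1) \<in> ?K - {p}" using \<open>k \<ge> 2\<close> by auto
    then have "?K - {p} \<noteq> {}" by blast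
    then show ?thesis unfolding N_def using card_pos by (intro sum_pos) auto
  qed
  \<comment> \<open>The total weight outside cluster \<open>p\<close> is bounded crudely by
    \<open>m\<close>, which matches the \<open>m\<close> in well-separation.\<close>
  have N_le: "N p \<le> real m" for p
  proof -
    have "N p \<le> (\<Sum>q\<in>?K. real (card (S q)))"
      unfolding N_def by (intro sum_mono2) auto
    also have "\<dots> = (\<Sum>i\<in>?I. 1)"
      using L_mem by (subst sum_by_label[of ?I ?K L]) (auto simp: S_eq)
    finally show ?thesis by simp
  qed
  have v_eq: "(\<Sum>q\<in>?K - {p}. real (card (S q)) *\<^sub>R normalize_vec (\<beta> p - \<beta> q)) = N p *\<^sub>R v p"
    if "p \<in> ?K" for p
    using N_pos[OF that] that assms(7) by (simp add: mean_direction_def N_def)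
  have norm_v: "norm (N p *\<^sub>R v p) \<le> N p" if "p \<in> ?K" for p
  proof -
    have "norm (N p *\<^sub>R v p) \<le> (\<Sum>q\<in>?K - {p}. real (card (S q)) * 1)"
      unfolding v_eq[OF that, symmetric]
      by (intro order.trans[OF norm_sum] sum_mono)
        (auto intro!: mult_left_le norm_normalize_vec_le)
    then show ?thesis by (simp add: N_def)
  qed

  \<comment> \<open>The well-separation constant\<close>
  define c where
    "c = (MAX p\<in>?K. MAX i\<in>S p. norm (proj_perp (v p) *v a i) / norm (proj_span (v p) *v a i))"
  have slope_le: "norm (slope_vec (v p) (a i)) \<le> c" if "p \<in> ?K" "i \<in> S p" for p i
  proof -
    have "norm (slope_vec (v p) (a i)) \<le> norm (proj_perp (v p) *v a i) / norm (proj_span (v p) *v a i)"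
      by (rule norm_slope_vec_le)
    also have "\<dots> \<le> (MAX i\<in>S p. norm (proj_perp (v p) *v a i) / norm (proj_span (v p) *v a i))"
      using that fin by (intro Max_ge) auto
    also have "\<dots> \<le> c"
      unfolding c_def using that by (intro Max_ge) auto
    finally show ?thesis .
  qed
  have c_less: "2 * real m * c < real (card (S p))" if "p \<in> ?K" for p
  proof -
    have "(MIN p\<in>?K. real (card (S p)) / real m) \<le> real (card (S p)) / real m"
      using that by (intro Min_le) auto
    then have "2 * c < real (card (S p)) / real m"
      using well_separation unfolding c_def by linarith
    then show ?thesis using \<open>m \<ge> 1\<close> by (simp add: field_simps)
  qed
  have c_nonneg: "0 \<le> c"
  proof -
    have "1 \<in> ?K" using \<open>k \<ge> 2\<close> by simp
    then obtain i where "i \<in> S 1" using ne by blast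
    then show ?thesis using slope_le[of 1 i] \<open>1 \<in> ?K\<close> norm_ge_zero order.trans by blast
  qed

  \<comment> \<open>Optimality and uniqueness\<close>
  have feas0: "feasible m a b z0"
    using L_mem assms(6) by (auto simp: feasible_def z0_def)

  \<comment> \<open>With a non-strict inequality as hypothesis, this one claim yields both facts: a
    strictly better point would have to equal \<open>z0\<close>, which is absurd.\<close>
  have unique: "z = z0" if z: "feasible m a b z" and le: "objective m z \<le> objective m z0" for z
  proof -
    define h where "h i = z i - \<beta> (L i)" for i
    have orth: "a i \<bullet> h i = 0" if "i \<in> ?I" for i
      using that z L_mem[OF that] assms(6)[of "L i" i]
      by (simp add: h_def inner_diff_right feasible_def)
    let ?T = "\<lambda>p. (\<Sum>i\<in>S p. \<Sum>j\<in>S p. norm (h i - h j)) + 2 * (\<Sum>i\<in>S p. (N p *\<^sub>R v p) \<bullet> h i)"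
    have obj_z0: "objective m z0 = (\<Sum>i\<in>?I. \<Sum>j\<in>?I. norm (\<beta> (L i) - \<beta> (L j)))"
      by (simp add: objective_def z0_def)
    have obj_z: "objective m z = (\<Sum>i\<in>?I. \<Sum>j\<in>?I. norm ((\<beta> (L i) + h i) - (\<beta> (L j) + h j)))"
      by (simp add: objective_def h_def)
    have "objective m z0 + (\<Sum>p\<in>?K. ?T p) \<le> objective m z"
      unfolding obj_z0 obj_z
      using objective_excess[of ?I ?K L S \<beta> h, OF _ _ L_mem(1) S_eq]
      by (simp only: v_eq finite_atLeastAtMost simp_thms cong: sum.cong)
    then have T_sum: "(\<Sum>p\<in>?K. ?T p) \<le> 0" using le by simp
    have T: "0 \<le> ?T p" "?T p = 0 \<Longrightarrow> i \<in> S p \<Longrightarrow> j \<in> S p \<Longrightarrow> h i = h j" if p: "p \<in> ?K" for p i j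
    proof -
      have inner: "(N p *\<^sub>R v p) \<bullet> h i = - norm (N p *\<^sub>R v p) * (slope_vec (v p) (a i) \<bullet> h i)"
        if "i \<in> S p" for i
      proof -
        have "i \<in> ?I" using S_eq[OF p] that by simp
        then have "v p \<bullet> h i = - norm (v p) * (slope_vec (v p) (a i) \<bullet> h i)"
          by (intro inner_orthogonal_eq_slope_vec assms(9) p that orth)
        then show ?thesis using N_pos[OF p] by simp
      qed
      have sum0: "(\<Sum>i\<in>S p. slope_vec (v p) (a i)) = 0"
        using balance[OF p] by (simp add: slope_vec_def)
      \<comment> \<open>The cluster estimate is instantiated with \<open>N = 2 * real m * c\<close>,
        \<open>C = real m\<close> and \<open>s = norm (N p *\<^sub>R v p)\<close>.\<close>
      have "0 \<le> 2 * real m * c" using c_nonneg by simp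
      note * = cluster_excess_nonneg[OF fin[OF p] this c_less[OF p] slope_le[OF p] order.refl
          sum0 inner norm_ge_zero order.trans[OF norm_v[OF p] N_le]]
      show "0 \<le> ?T p" by (rule *(1))
      show "?T p = 0 \<Longrightarrow> i \<in> S p \<Longrightarrow> j \<in> S p \<Longrightarrow> h i = h j" by (rule *(2))
    qed
    have T0: "?T p = 0" if "p \<in> ?K" for p
    proof -
      have "(\<Sum>p\<in>?K. ?T p) = 0" using T_sum sum_nonneg[of ?K ?T] T(1) by force
      then show ?thesis using that T(1) sum_nonneg_eq_0_iff[of ?K ?T] by blast
    qed
    have h0: "h i = 0" if "i \<in> ?I" for i
    proof -
      note p = L_mem[OF that]
      \<comment> \<open>Since \<open>h\<close> is constant on the cluster, \<open>h i\<close>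
        inherits the constraint of every \<open>j\<close> there, hence is orthogonal to a spanning
        set and to itself.\<close>
      have "a j \<bullet> h i = 0" if "j \<in> S (L i)" for j
        using T(2)[OF p(1) T0[OF p(1)] that p(2)] orth[of j] that S_eq[OF p(1)] by auto
      then have "orthogonal (h i) x" if "x \<in> a ` S (L i)" for x
        using that by (auto simp: orthogonal_def inner_commute)
      then have "orthogonal (h i) (h i)"
        using spanning[OF p(1)] by (intro orthogonal_to_span[of "h i" "a ` S (L i)"]) auto
      then show ?thesis by (simp add: orthogonal_def)
    qed
    show "z = z0"
    proof
      fix i
      show "z i = z0 i"
      proof (cases "i \<in> ?I")
        case True
        then show ?thesis using h0[OF True] by (simp add: h_def z0_def)
      next
        case False
        \<comment> \<open>Outside the index range both tuples take the value
          \<open>undefined\<close>.\<close>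
        have "z \<in> ?I \<rightarrow>\<^sub>E UNIV" using z by (simp add: feasible_def)
        then have "z i = undefined" using False by (rule PiE_arb)
        with False show ?thesis by (simp only: z0_def restrict_apply if_False)
      qed
    qed
  qed
  show ?thesis
    unfolding L_def[symmetric] z0_def[symmetric]
  proof (intro set_eqI iffI)
    fix z assume "z \<in> {z. is_arg_min (objective m) (feasible m a b) z}"
    then have "feasible m a b z" "objective m z \<le> objective m z0"
      using feas0 by (auto simp: is_arg_min_def not_less)
    then show "z \<in> {z0}" using unique by simp
  next
    fix z assume "z \<in> {z0}"
    moreover have "\<not> objective m y < objective m z0" if "feasible m a b y" for y
      using unique[OF that] by force
    ultimately show "z \<in> {z. is_arg_min (objective m) (feasible m a b) z}"
      using feas0 by (simp add: is_arg_min_def)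
  qed
qed

end
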